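(* If $k\ge3$ is odd, then $\mathcal{O}(\mathbb{C},k)=\emptyset$; that is, every overlap in $\mathbb{C}$ with respect to $\phi=\exp(2\pi\mathrm{i}/k)$ is trivial.
   Context: $\mathbf{k}=\{1,\dots,k-1\}$, $\mathbf{k}_0=\{0,\dots,k-1\}$. A quadruple $(i,j\mid s,t)\in\mathbf{k}^4$ with $i\ne s$ is an overlap if $\phi^\omega(\phi^j-1)(\phi^s-1)=(\phi^i-1)(\phi^t-1)$ for some $\omega\in\mathbf{k}_0$; it is trivial if one of $i\equiv\pm j$, $j\equiv\pm t$, $t\equiv\pm s$, $s\equiv\pm i\pmod k$ holds, nontrivial otherwise. $\mathcal{O}(\mathbb{C},k)$ is the set of nontrivial overlaps. *)

theory Defs
  imports Complex_Main "HOL-Number_Theory.Cong"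
begin

definition phi :: "nat \<Rightarrow> complex" where
  "phi k = exp (2 * of_real pi * \<i> / of_nat k)"

definition kset :: "nat \<Rightarrow> nat set" where
  "kset k = {1..<k}"

definition kset0 :: "nat \<Rightarrow> nat set" where
  "kset0 k = {0..<k}"

definition is_overlap :: "nat \<Rightarrow> nat \<Rightarrow> nat \<Rightarrow> nat \<Rightarrow> nat \<Rightarrow> bool" where
  "is_overlap k i j s t \<longleftrightarrow>
     i \<in> kset k \<and> j \<in> kset k \<and> s \<in> kset k \<and> t \<in> kset k \<and> i \<noteq> s \<and>
     (\<exists>\<omega>\<in>kset0 k. phi k ^ \<omega> * (phi k ^ j - 1) * (phi k ^ s - 1)
                   = (phi k ^ i - 1) * (phi k ^ t - 1))"

definition pm_cong :: "nat \<Rightarrow> nat \<Rightarrow> nat \<Rightarrow> bool" where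
  "pm_cong k a b \<longleftrightarrow> [int a = int b] (mod int k) \<or> [int a = - int b] (mod int k)"

definition trivial_overlap :: "nat \<Rightarrow> nat \<Rightarrow> nat \<Rightarrow> nat \<Rightarrow> nat \<Rightarrow> bool" where
  "trivial_overlap k i j s t \<longleftrightarrow>
     pm_cong k i j \<or> pm_cong k j t \<or> pm_cong k t s \<or> pm_cong k s i"

definition nontrivial_overlaps :: "nat \<Rightarrow> (nat \<times> nat \<times> nat \<times> nat) set" where
  "nontrivial_overlaps k =
     {(i, j, s, t). is_overlap k i j s t \<and> \<not> trivial_overlap k i j s t}"

end

theory Submission
  imports Defs "HOL-Computational_Algebra.Polynomial_Factorial" "HOL-Library.Z2"
begin

text \<open>
  For odd \<open>k\<close> the map \<open>\<phi> \<mapsto> \<phi>\<^sup>2\<close> preserves integer polynomial relations. Applying it to an overlap and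
  dividing by the overlap itself gives
  \<open>\<phi>\<^sup>\<omega> (\<phi>\<^sup>j + 1) (\<phi>\<^sup>s + 1) = (\<phi>\<^sup>i + 1) (\<phi>\<^sup>t + 1)\<close>.
  The sum and the difference of the two equations say that
  \<open>\<phi>\<^sup>\<omega> + \<phi>\<^bsup>\<omega>+j+s\<^esup> = 1 + \<phi>\<^bsup>i+t\<^esup>\<close> and \<open>\<phi>\<^bsup>\<omega>+j\<^esup> + \<phi>\<^bsup>\<omega>+s\<^esup> = \<phi>\<^sup>i + \<phi>\<^sup>t\<close>.
  A nonzero sum of two complex numbers of modulus 1 determines its summands, and these sums are
  nonzero because \<open>-1\<close> is not a \<open>k\<close>-th root of unity; comparing exponents leaves only trivial
  overlaps.
\<close>

text \<open>These default simplification rules turn the field operations on bits into XOR and AND.\<close>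

declare add_bit_eq_xor [simp del] mult_bit_eq_and [simp del] minus_bit_def [simp del]

section \<open>Integer polynomials read in a commutative ring\<close>

lemma of_int_poly_mult:
  "map_poly of_int (p * q) =
     (map_poly of_int p * map_poly of_int q :: 'a :: comm_ring_1 poly)"
  by (rule poly_eqI) (simp add: coeff_map_poly coeff_mult)

lemma of_int_poly_add:
  "map_poly of_int (p + q) =
     (map_poly of_int p + map_poly of_int q :: 'a :: comm_ring_1 poly)"
  by (rule poly_eqI) (simp add: coeff_map_poly)

lemma of_int_poly_diff:
  "map_poly of_int (p - q) =
     (map_poly of_int p - map_poly of_int q :: 'a :: comm_ring_1 poly)"
  by (rule poly_eqI) (simp add: coeff_map_poly)

lemma of_int_poly_smult:
  "map_poly of_int (smult c p) =
     (smult (of_int c) (map_poly of_int p) :: 'a :: comm_ring_1 poly)"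
  by (rule poly_eqI) (simp add: coeff_map_poly)

lemma of_int_poly_monom:
  "map_poly of_int (monom c n) = (monom (of_int c) n :: 'a :: comm_ring_1 poly)"
  by (rule poly_eqI) (simp add: coeff_map_poly)

lemma of_int_poly_pcompose:
  "map_poly of_int (pcompose p q) =
     (pcompose (map_poly of_int p) (map_poly of_int q) :: 'a :: comm_ring_1 poly)"
  by (induction p) (simp_all add: pcompose_pCons map_poly_pCons of_int_poly_add of_int_poly_mult)

lemmas of_int_poly_simps =
  of_int_poly_mult of_int_poly_add of_int_poly_diff of_int_poly_smult
  of_int_poly_monom of_int_poly_pcompose

text \<open>Gauss's lemma in disguise: the primitive part of an annihilator of least degree
  generates over the integers, so divisibility by it survives reduction modulo 2.\<close>

lemma ex_generator_annihilating_int_polys: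
  fixes z :: "'a :: field_char_0"
  assumes "p \<noteq> 0" "poly (map_poly of_int p) z = 0"
  obtains f :: "int poly" where
    "f \<noteq> 0" "poly (map_poly of_int f) z = 0"
    "\<And>h. poly (map_poly of_int h) z = 0 \<Longrightarrow> f dvd h"
proof -
  let ?ann = "\<lambda>f :: int poly. f \<noteq> 0 \<and> poly (map_poly of_int f) z = 0"
  obtain g where g: "?ann g" and min: "\<And>h. ?ann h \<Longrightarrow> degree g \<le> degree h"
    using ex_has_least_nat[of ?ann p degree] assms by blast
  define f where "f = primitive_part g"
  have g_eq: "g = smult (content g) f"
    by (simp add: f_def)
  have f0: "f \<noteq> 0" and deg: "degree f = degree g" and cont: "content f = 1"
    using g by (simp_all add: f_def)
  have "poly (map_poly of_int g) z = of_int (content g) * poly (map_poly of_int f) z"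
    by (subst g_eq) (simp add: of_int_poly_smult del: content_times_primitive_part)
  then have fz: "poly (map_poly of_int f) z = 0"
    using g by simp
  have "f dvd h" if h: "poly (map_poly of_int h) z = 0" for h
  proof -
    obtain a q where a: "a \<noteq> 0" and eq: "smult a h = f * q + pseudo_mod h f"
      using pseudo_mod(1)[OF f0, of h] by blast
    have "poly (map_poly of_int (pseudo_mod h f)) z = 0"
      using arg_cong[OF eq, of "\<lambda>p. poly (map_poly of_int p) z"] h fz
      by (simp add: of_int_poly_simps)
    then have "pseudo_mod h f = 0"
      using pseudo_mod(2)[OF f0, of h] min deg by fastforce
    then have "f dvd smult a h"
      using eq by simp
    \<comment> \<open>The factor \<open>a\<close> from pseudo-division is a unit over the fraction
      field; \<open>content f = 1\<close> brings the divisibility back to the integers.\<close>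
    then have "fract_poly f dvd smult (to_fract a) (fract_poly h)"
      by (metis fract_poly_dvd fract_poly_smult)
    then have "fract_poly f dvd fract_poly h"
      using a by (simp add: dvd_smult_iff)
    then show ?thesis
      using cont by (rule fract_poly_dvdD)
  qed
  with f0 fz show ?thesis
    by (rule that)
qed

section \<open>Reduction modulo 2\<close>

text \<open>Frobenius: squaring has no cross terms in characteristic 2 and fixes each
  coefficient.\<close>

lemma pcompose_bit_square:
  fixes p :: "bit poly"
  shows "pcompose p (monom 1 2) = p\<^sup>2"
proof (induction p)
  case (pCons a p)
  have two: "(2 :: bit poly) = 0"
    by (metis bit_2_eq_0 numeral_poly pCons_0_0)
  have "[:a:] * [:a:] = [:a:]"
    by (cases a) auto
  then have "[:a:] + monom 1 2 * p\<^sup>2 = ([:a:] + monom 1 1 * p)\<^sup>2"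
    by (simp add: power2_sum power_mult_distrib monom_power two power2_eq_square[of "[:a:]"])
  moreover have "pCons a p = [:a:] + monom 1 1 * p"
    by (simp add: monom_altdef)
  moreover have "pcompose (pCons a p) (monom 1 2) = [:a:] + monom 1 2 * p\<^sup>2"
    by (simp add: pcompose_pCons pCons(2))
  ultimately show ?case
    by simp
qed simp

lemma dvd_square_cofactor_imp_unit:
  fixes f g :: "'a :: field poly"
  assumes k: "of_nat k \<noteq> (0 :: 'a)" and fg: "monom 1 k - 1 = f * g" and dvd: "f dvd g\<^sup>2"
  shows "f dvd 1"
proof -
  let ?x = "monom 1 1 :: 'a poly"
  have "k > 0"
    using k by (cases k) auto
  txt \<open>Euler's identity \<open>X P' - k P = k\<close> for \<open>P = X\<^sup>k - 1\<close> makes \<open>f\<close> and \<open>g\<close> coprime.\<close>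
  have "?x * pderiv (f * g) - smult (of_nat k) (f * g) = [:of_nat k:]"
    using \<open>k > 0\<close>
    by (simp add: fg[symmetric] pderiv_diff pderiv_monom mult_monom smult_diff_right smult_monom)
  then have "[:of_nat k:] = f * (?x * pderiv g - smult (of_nat k) g) + g * (?x * pderiv f)"
    by (simp add: pderiv_mult algebra_simps)
  \<comment> \<open>Squaring the identity makes \<open>g\<close> enter only through
    \<open>g\<^sup>2\<close>, the multiple of \<open>f\<close> that is given.\<close>
  then have "[:of_nat k:] * [:of_nat k:] =
      f * ((?x * pderiv g - smult (of_nat k) g) *
        (f * (?x * pderiv g - smult (of_nat k) g) + 2 * (g * (?x * pderiv f))))
      + g\<^sup>2 * (?x * pderiv f)\<^sup>2"
    by (simp only:) (simp add: algebra_simps power2_eq_square)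
  then have "f dvd [:of_nat k:] * [:of_nat k:]"
    using dvd by (metis dvd_add dvd_mult2 dvd_triv_left)
  moreover have "[:of_nat k:] * [:of_nat k:] dvd (1 :: 'a poly)"
    using k by (simp add: is_unit_const_poly_iff dvd_field_iff)
  ultimately show ?thesis
    by (rule dvd_trans)
qed

text \<open>
  The step of Dedekind's irreducibility proof for cyclotomic polynomials at the prime 2: if the
  minimal polynomial \<open>f\<close> of \<open>z\<close> did not vanish at \<open>z\<^sup>2\<close>, its cofactor \<open>g\<close> in \<open>X\<^sup>k - 1\<close> would, so
  \<open>f\<close> would divide \<open>g(X\<^sup>2) \<equiv> g(X)\<^sup>2\<close> modulo 2, although \<open>X\<^sup>k - 1\<close> is separable modulo 2.
\<close>

lemma int_poly_root_square_of_odd_root_unity: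
  fixes z :: "'a :: field_char_0"
  assumes "odd k" and zk: "z ^ k = 1" and Pz: "poly (map_poly of_int P) z = 0"
  shows "poly (map_poly of_int P) (z\<^sup>2) = 0"
proof -
  define X :: "int poly" where "X = monom 1 k - 1"
  have [simp]: "map_poly of_int X = (monom 1 k - 1 :: 'b :: comm_ring_1 poly)"
    by (simp add: X_def of_int_poly_simps)
  have "k > 0"
    using \<open>odd k\<close> by (cases k) auto
  then have lcX: "lead_coeff X = 1"
    using degree_add_eq_left[of "- 1" "monom 1 k :: int poly"]
    by (simp add: X_def degree_monom_eq)
  then have X0: "X \<noteq> 0"
    by auto
  have Xz: "poly (map_poly of_int X) z = 0"
    using zk by (simp add: poly_monom)
  obtain f :: "int poly" where f0: "f \<noteq> 0" and fz: "poly (map_poly of_int f) z = 0"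
    and fmin: "\<And>h. poly (map_poly of_int h) z = 0 \<Longrightarrow> f dvd h"
    using ex_generator_annihilating_int_polys[OF X0 Xz] by metis
  obtain g where X: "X = f * g"
    using fmin[OF Xz] ..
  have "poly (map_poly of_int f) (z\<^sup>2) = 0"
  proof (rule ccontr)
    assume nz: "poly (map_poly of_int f) (z\<^sup>2) \<noteq> 0"
    have "poly (map_poly of_int X) (z\<^sup>2) = 0"
      using zk by (simp add: poly_monom flip: power_mult) (simp add: mult.commute power_mult)
    then have "poly (map_poly of_int g) (z\<^sup>2) = 0"
      using nz by (simp only: X of_int_poly_mult poly_mult) simp
    then have "f dvd pcompose g (monom 1 2)"
      by (intro fmin) (simp add: of_int_poly_simps poly_pcompose poly_monom)
    then obtain h where "pcompose g (monom 1 2) = f * h" ..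
    then have "map_poly of_int g ^ 2 = (map_poly of_int f * map_poly of_int h :: bit poly)"
      by (metis of_int_poly_mult of_int_poly_pcompose of_int_poly_monom of_int_1 pcompose_bit_square)
    then have "map_poly of_int f dvd (map_poly of_int g ^ 2 :: bit poly)"
      by simp
    moreover have "monom 1 k - 1 = (map_poly of_int f * map_poly of_int g :: bit poly)"
      by (simp flip: of_int_poly_mult X)
    moreover have "of_nat k \<noteq> (0 :: bit)"
      using \<open>odd k\<close> by (auto elim!: oddE)
    ultimately have "map_poly of_int f dvd (1 :: bit poly)"
      using dvd_square_cofactor_imp_unit by blast
    \<comment> \<open>As a divisor of the monic \<open>X\<close>, \<open>f\<close> has a unit as
      leading coefficient, so its degree does not drop modulo 2. A unit modulo 2 is then constant
      already over the integers, and a nonzero constant cannot vanish at \<open>z\<close>.\<close>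
    moreover have "degree (map_poly of_int f :: bit poly) = degree f"
    proof (rule antisym)
      have "lead_coeff f * lead_coeff g = 1"
        using lcX by (simp add: X lead_coeff_mult)
      then have "of_int (lead_coeff f) * of_int (lead_coeff g) = (1 :: bit)"
        by (metis of_int_1 of_int_mult)
      then have "of_int (lead_coeff f) \<noteq> (0 :: bit)"
        by (metis mult_zero_left zero_neq_one)
      then show "degree f \<le> degree (map_poly of_int f :: bit poly)"
        by (intro le_degree) (simp add: coeff_map_poly)
      show "degree (map_poly of_int f :: bit poly) \<le> degree f"
        by (intro degree_le) (simp add: coeff_map_poly coeff_eq_0)
    qed
    ultimately have "degree f = 0"
      by (metis is_unit_iff_degree not_is_unit_0)
    then show False
      using f0 fz by (auto elim!: degree_eq_zeroE simp: map_poly_pCons)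
  qed
  moreover obtain q where "P = f * q"
    using fmin[OF Pz] ..
  ultimately show ?thesis
    by (simp add: of_int_poly_mult)
qed

section \<open>Roots of unity and the overlap equation\<close>

text \<open>Conjugation is inversion on the unit circle, so conjugating a nonzero sum fixes the
  product as well; both pairs are then the roots of one quadratic.\<close>

lemma unit_pair_sum_eq:
  fixes a b c d :: complex
  assumes "norm a = 1" "norm b = 1" "norm c = 1" "norm d = 1"
    and sum: "a + b = c + d" and "a + b \<noteq> 0"
  shows "a = c \<and> b = d \<or> a = d \<and> b = c"
proof -
  have n: "x * cnj x = 1" if "norm x = 1" for x
    using that by (simp add: complex_norm_square[symmetric])
  have "cnj a + cnj b = cnj c + cnj d"
    using sum by (metis complex_cnj_add)
  then have "a * b * c * d * (cnj a + cnj b) = a * b * c * d * (cnj c + cnj d)"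
    by simp
  then have "c * d * (b * (a * cnj a) + a * (b * cnj b)) = a * b * (d * (c * cnj c) + c * (d * cnj d))"
    by (simp add: algebra_simps)
  then have "c * d * (a + b) = a * b * (a + b)"
    using assms n by (simp add: algebra_simps sum)
  then have "a * b = c * d"
    using \<open>a + b \<noteq> 0\<close> by simp
  then have "(a - c) * (a - d) = 0"
    using sum by algebra
  then show ?thesis
    using sum by auto
qed

lemma odd_roots_unity_add_neq_0:
  fixes a b :: "'a :: field_char_0"
  assumes "odd k" "a ^ k = 1" "b ^ k = 1"
  shows "a + b \<noteq> 0"
proof
  assume "a + b = 0"
  then have "a = - b"
    by (simp add: eq_neg_iff_add_eq_0)
  then show False
    using assms by simp
qed

lemma phi_power: "phi k ^ n = cis (2 * pi * real n / real k)"
  by (simp add: phi_def cis_conv_exp mult_ac flip: exp_of_nat_mult)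

lemma phi_power_eq_iff:
  assumes "k > 0"
  shows "phi k ^ m = phi k ^ n \<longleftrightarrow> [m = n] (mod k)"
proof -
  have "phi k ^ k = 1"
    using assms by (simp add: phi_power)
  then have mod: "phi k ^ n = phi k ^ (n mod k)" for n
    by (metis mult_div_mod_eq power_add power_mult power_one mult_1)
  have "inj_on (\<lambda>n. phi k ^ n) {..<k}"
    using bij_betw_roots_unity[OF assms] by (simp add: phi_power bij_betw_def)
  then have "phi k ^ (m mod k) = phi k ^ (n mod k) \<longleftrightarrow> m mod k = n mod k"
    using assms by (intro inj_on_eq_iff[of "\<lambda>n. phi k ^ n"]) auto
  then show ?thesis
    by (simp add: cong_def flip: mod)
qed

theorem theorem27:
  fixes k :: nat
  assumes "odd k" and "k \<ge> 3"
  shows "nontrivial_overlaps k = {}"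
proof -
  have "k > 0" using assms by simp
  have triv: "trivial_overlap k i j s t" if ov: "is_overlap k i j s t" for i j s t
  proof -
    define z where "z = phi k"
    have zeq: "z ^ m = z ^ n \<longleftrightarrow> [m = n] (mod k)" for m n
      using phi_power_eq_iff \<open>k > 0\<close> by (auto simp: z_def)
    have z1: "z ^ n = 1 \<longleftrightarrow> k dvd n" for n
      using zeq[of n 0] by (simp add: cong_0_iff)
    have zk: "z ^ k = 1"
      by (simp add: z1)
    have nz: "z ^ n \<noteq> 1" if "n \<in> kset k" for n
      using that by (auto simp: z1 kset_def dest: dvd_imp_le)
    have norm_z: "norm (z ^ n) = 1" for n
      by (simp add: z_def phi_def norm_power)
    have sum_nz: "z ^ m + z ^ n \<noteq> 0" for m n
      by (rule odd_roots_unity_add_neq_0[OF \<open>odd k\<close>]) (simp_all add: z1 flip: power_mult)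
    from ov obtain w where mem: "i \<in> kset k" "j \<in> kset k" "s \<in> kset k" "t \<in> kset k"
      and eq: "z ^ w * (z ^ j - 1) * (z ^ s - 1) = (z ^ i - 1) * (z ^ t - 1)"
      by (auto simp: is_overlap_def z_def)
    define P :: "int poly" where "P = monom 1 w * (monom 1 j - 1) * (monom 1 s - 1)
      - (monom 1 i - 1) * (monom 1 t - 1)"
    have P: "poly (map_poly of_int P) x =
        x ^ w * (x ^ j - 1) * (x ^ s - 1) - (x ^ i - 1) * (x ^ t - 1)" for x :: complex
      by (simp add: P_def of_int_poly_simps poly_monom)
    have "(z\<^sup>2) ^ w * ((z\<^sup>2) ^ j - 1) * ((z\<^sup>2) ^ s - 1) = ((z\<^sup>2) ^ i - 1) * ((z\<^sup>2) ^ t - 1)"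
      using int_poly_root_square_of_odd_root_unity[OF \<open>odd k\<close> zk, of P] eq unfolding P by simp
    moreover have "(z\<^sup>2) ^ n = z ^ n * z ^ n" for n
      by (simp add: power2_eq_square power_mult_distrib)
    ultimately have "(z ^ w * (z ^ j - 1) * (z ^ s - 1)) * (z ^ w * (z ^ j + 1) * (z ^ s + 1))
        = ((z ^ i - 1) * (z ^ t - 1)) * ((z ^ i + 1) * (z ^ t + 1))"
      by (simp add: algebra_simps)
    \<comment> \<open>Rewriting with \<open>eq\<close> gives both sides the common factor
      \<open>(z ^ i - 1) * (z ^ t - 1)\<close>, which \<open>nz\<close> allows to cancel.\<close>
    then have eq2: "z ^ w * (z ^ j + 1) * (z ^ s + 1) = (z ^ i + 1) * (z ^ t + 1)"
      unfolding eq using nz mem by simp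
    have "2 * (z ^ w + z ^ (w + j + s)) = 2 * (z ^ 0 + z ^ (i + t))"
      using arg_cong2[OF eq eq2, of "(+)"] by (simp add: algebra_simps power_add)
    then have "z ^ w + z ^ (w + j + s) = z ^ 0 + z ^ (i + t)"
      by (subst (asm) mult_left_cancel) simp_all
    then have "z ^ w = z ^ 0 \<and> z ^ (w + j + s) = z ^ (i + t) \<or>
        z ^ w = z ^ (i + t) \<and> z ^ (w + j + s) = z ^ 0"
      by (intro unit_pair_sum_eq norm_z sum_nz)
    moreover have "2 * (z ^ (w + j) + z ^ (w + s)) = 2 * (z ^ i + z ^ t)"
      using arg_cong2[OF eq2 eq, of "(-)"] by (simp add: algebra_simps power_add)
    then have "z ^ (w + j) + z ^ (w + s) = z ^ i + z ^ t"
      by (subst (asm) mult_left_cancel) simp_all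
    then have "z ^ (w + j) = z ^ i \<and> z ^ (w + s) = z ^ t \<or>
        z ^ (w + j) = z ^ t \<and> z ^ (w + s) = z ^ i"
      by (intro unit_pair_sum_eq norm_z sum_nz)
    ultimately have "(int k dvd w \<and> int k dvd int w + j + s - (i + t) \<or>
          int k dvd int w - (i + t) \<and> int k dvd int w + j + s) \<and>
        (int k dvd int w + j - i \<and> int k dvd int w + s - t \<or>
         int k dvd int w + j - t \<and> int k dvd int w + s - i)"
      unfolding zeq by (simp add: cong_iff_dvd_diff flip: cong_int_iff)
    \<comment> \<open>Subtraction eliminates \<open>w\<close>: modulo \<open>k\<close>,
      \<open>w = 0\<close> leaves \<open>i = j\<close> or \<open>j = t\<close>, and
      \<open>w + j + s = 0\<close> leaves \<open>j = -t\<close> or \<open>i = -j\<close>.\<close>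
    then have "int k dvd int i - j \<or> int k dvd int j - t \<or> int k dvd int j + t \<or> int k dvd int i + j"
    proof (elim conjE disjE)
      assume "int k dvd w" "int k dvd int w + j - i"
      from dvd_diff[OF this] show ?thesis by (simp add: algebra_simps)
    next
      assume "int k dvd w" "int k dvd int w + j - t"
      from dvd_diff[OF this(2,1)] show ?thesis by (simp add: algebra_simps)
    next
      assume "int k dvd int w + j + s" "int k dvd int w + s - t"
      from dvd_diff[OF this] show ?thesis by (simp add: algebra_simps)
    next
      assume "int k dvd int w + j + s" "int k dvd int w + s - i"
      from dvd_diff[OF this] show ?thesis by (simp add: algebra_simps)
    qed
    then show ?thesis
      by (auto simp: trivial_overlap_def pm_cong_def cong_iff_dvd_diff)
  qed
  then show ?thesis
    by (auto simp: nontrivial_overlaps_def)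
qed

end
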